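(* Let $M$ be a matroid on a finite ground set $E$ with set of bases $\mathcal{B}$, and let $<$ be a linear order on $E$. Then any linear extension of Las Vergnas's external/internal order $<_{ext/int}$ on $\mathcal{B}$, transported to the facets via $B\mapsto F(B)$, is a shelling order of the external activity complex $\mathrm{Act}_<(M)$. In particular $\mathrm{Act}_<(M)$ is shellable.
   Context: For a basis $B$ and $e\in E-B$, $\mathrm{Circ}(B,e)$ is the unique circuit contained in $B\cup e$; for $i\in B$, $\mathrm{Cocirc}(B,i)=\{x\in E: B\cup x-i\in\mathcal{B}\}$. Define $EA(B)=\{e\in E-B: e=\min\mathrm{Circ}(B,e)\}$, $EP(B)=(E-B)-EA(B)$, $IA(B)=\{i\in B: i=\min\mathrm{Cocirc}(B,i)\}$, $IP(B)=B-IA(B)$ (minima with respect to $<$). Let $\overline{E}=\{\overline{e}:e\in E\}$ be a disjoint copy of $E$ and for $S\subseteq E$ write $\overline{S}=\{\overline{s}:s\in S\}$. The external activity complex $\mathrm{Act}_<(M)$ is the simplicial complex on $E\sqcup\overline{E}$ whose facets are $F(B)=B\cup EP(B)\cup\overline{B\cup EA(B)}$ for $B\in\mathcal{B}$. The external/internal order on $\mathcal{B}$ is the partial order defined by $A\le_{ext/int}B$ iff $IP(A)\cap EP(B)=\emptyset$. A shelling order of a pure simplicial complex is an ordering $F_1,\dots,F_k$ of its facets such that for all $i<j$ there exist $l<j$ and $f\in F_j$ with $F_i\cap F_j\subseteq F_l\cap F_j=F_j-\{f\}$. *)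

theory Defs
  imports Main
begin

section \<open>Matroids given by their bases\<close>

locale matroid =
  fixes E :: "'a set" and \<B> :: "'a set set"
  assumes finite_ground: "finite E"
    and bases_subset: "B \<in> \<B> \<Longrightarrow> B \<subseteq> E"
    and bases_nonempty: "\<B> \<noteq> {}"
    and basis_exchange:
      "\<lbrakk>A \<in> \<B>; B \<in> \<B>; x \<in> A - B\<rbrakk> \<Longrightarrow> \<exists>y\<in>B - A. insert y (A - {x}) \<in> \<B>"

definition indep :: "'a set set \<Rightarrow> 'a set \<Rightarrow> bool" where
  "indep \<B> I \<longleftrightarrow> (\<exists>B\<in>\<B>. I \<subseteq> B)"

definition circuit :: "'a set \<Rightarrow> 'a set set \<Rightarrow> 'a set \<Rightarrow> bool" where
  "circuit E \<B> C \<longleftrightarrow> C \<subseteq> E \<and> \<not> indep \<B> C \<and> (\<forall>D. D \<subset> C \<longrightarrow> indep \<B> D)"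

definition Circ :: "'a set \<Rightarrow> 'a set set \<Rightarrow> 'a set \<Rightarrow> 'a \<Rightarrow> 'a set" where
  "Circ E \<B> B e = (THE C. circuit E \<B> C \<and> C \<subseteq> insert e B)"

text \<open>The set \<open>B \<union> x - i\<close> is read as \<open>(B - i) \<union> x\<close>, so that \<open>i\<close> itself belongs to
  \<open>Cocirc E \<B> B i\<close>; removing \<open>i\<close> last would wrongly exclude it.\<close>

definition Cocirc :: "'a set \<Rightarrow> 'a set set \<Rightarrow> 'a set \<Rightarrow> 'a \<Rightarrow> 'a set" where
  "Cocirc E \<B> B i = {x \<in> E. insert x (B - {i}) \<in> \<B>}"


section \<open>Activities\<close>

text \<open>Throughout, \<open>r\<close> is the reflexive relation \<open>\<le>\<close> of the linear order on the ground set: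
  \<open>(x, y) \<in> r\<close> means \<open>x \<le> y\<close>.\<close>

definition min_wrt :: "('a \<times> 'a) set \<Rightarrow> 'a set \<Rightarrow> 'a" where
  "min_wrt r X = (THE m. m \<in> X \<and> (\<forall>x\<in>X. (m, x) \<in> r))"

definition EA :: "'a set \<Rightarrow> 'a set set \<Rightarrow> ('a \<times> 'a) set \<Rightarrow> 'a set \<Rightarrow> 'a set" where
  "EA E \<B> r B = {e \<in> E - B. e = min_wrt r (Circ E \<B> B e)}"

definition EP :: "'a set \<Rightarrow> 'a set set \<Rightarrow> ('a \<times> 'a) set \<Rightarrow> 'a set \<Rightarrow> 'a set" where
  "EP E \<B> r B = (E - B) - EA E \<B> r B"

definition IA :: "'a set \<Rightarrow> 'a set set \<Rightarrow> ('a \<times> 'a) set \<Rightarrow> 'a set \<Rightarrow> 'a set" where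
  "IA E \<B> r B = {i \<in> B. i = min_wrt r (Cocirc E \<B> B i)}"

definition IP :: "'a set \<Rightarrow> 'a set set \<Rightarrow> ('a \<times> 'a) set \<Rightarrow> 'a set \<Rightarrow> 'a set" where
  "IP E \<B> r B = B - IA E \<B> r B"

definition ext_int_order ::
    "'a set \<Rightarrow> 'a set set \<Rightarrow> ('a \<times> 'a) set \<Rightarrow> ('a set \<times> 'a set) set" where
  "ext_int_order E \<B> r = {(A, B). A \<in> \<B> \<and> B \<in> \<B> \<and> IP E \<B> r A \<inter> EP E \<B> r B = {}}"

text \<open>A linear extension of an order \<open>R\<close> on a finite set \<open>A\<close>, given as the list of the elements
  of \<open>A\<close> in increasing order.\<close>

definition linear_extension :: "'b set \<Rightarrow> ('b \<times> 'b) set \<Rightarrow> 'b list \<Rightarrow> bool" where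
  "linear_extension A R xs \<longleftrightarrow> distinct xs \<and> set xs = A \<and>
     (\<forall>i<length xs. \<forall>j<length xs. (xs ! i, xs ! j) \<in> R \<longrightarrow> i \<le> j)"


section \<open>Simplicial complexes and shellings\<close>

text \<open>Elements of the vertex set \<open>V\<close> need not be faces: if \<open>e\<close> is a loop of the matroid, the
  vertex \<open>Inl e\<close> lies in no face of the external activity complex.\<close>

definition simplicial_complex :: "'v set \<Rightarrow> 'v set set \<Rightarrow> bool" where
  "simplicial_complex V \<Delta> \<longleftrightarrow> finite V \<and> \<Delta> \<subseteq> Pow V \<and> {} \<in> \<Delta> \<and>
     (\<forall>\<sigma>\<in>\<Delta>. \<forall>\<tau>. \<tau> \<subseteq> \<sigma> \<longrightarrow> \<tau> \<in> \<Delta>)"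

definition facets :: "'v set set \<Rightarrow> 'v set set" where
  "facets \<Delta> = {\<sigma> \<in> \<Delta>. \<forall>\<tau>\<in>\<Delta>. \<sigma> \<subseteq> \<tau> \<longrightarrow> \<tau> = \<sigma>}"

definition pure_complex :: "'v set \<Rightarrow> 'v set set \<Rightarrow> bool" where
  "pure_complex V \<Delta> \<longleftrightarrow> simplicial_complex V \<Delta> \<and>
     (\<forall>\<sigma>\<in>facets \<Delta>. \<forall>\<tau>\<in>facets \<Delta>. card \<sigma> = card \<tau>)"

definition shelling_order :: "'v set \<Rightarrow> 'v set set \<Rightarrow> 'v set list \<Rightarrow> bool" where
  "shelling_order V \<Delta> Fs \<longleftrightarrow> pure_complex V \<Delta> \<and> distinct Fs \<and> set Fs = facets \<Delta> \<and>
     (\<forall>j<length Fs. \<forall>i<j. \<exists>l<j. \<exists>f\<in>Fs ! j.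
        Fs ! i \<inter> Fs ! j \<subseteq> Fs ! l \<inter> Fs ! j \<and> Fs ! l \<inter> Fs ! j = Fs ! j - {f})"

definition shellable :: "'v set \<Rightarrow> 'v set set \<Rightarrow> bool" where
  "shellable V \<Delta> \<longleftrightarrow> (\<exists>Fs. shelling_order V \<Delta> Fs)"


section \<open>The external activity complex\<close>

text \<open>The vertex set is the disjoint sum \<open>E <+> E\<close>: \<open>Inl e\<close> is the element \<open>e\<close> itself and
  \<open>Inr e\<close> its barred copy.\<close>

definition act_facet ::
    "'a set \<Rightarrow> 'a set set \<Rightarrow> ('a \<times> 'a) set \<Rightarrow> 'a set \<Rightarrow> ('a + 'a) set" where
  "act_facet E \<B> r B = (B \<union> EP E \<B> r B) <+> (B \<union> EA E \<B> r B)"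

text \<open>The complex generated by the sets \<open>act_facet E \<B> r B\<close>. That these are exactly its facets
  is part of the assertion that a list of them is a shelling order.\<close>

definition Act :: "'a set \<Rightarrow> 'a set set \<Rightarrow> ('a \<times> 'a) set \<Rightarrow> ('a + 'a) set set" where
  "Act E \<B> r = {\<sigma>. \<exists>B\<in>\<B>. \<sigma> \<subseteq> act_facet E \<B> r B}"

end

theory Submission
  imports Defs
begin

text \<open>Suppose \<open>A\<close> precedes \<open>B\<close>. Then \<open>B \<le> A\<close> fails, so some \<open>b\<close> lies in both \<open>IP(B)\<close> and
  \<open>EP(A)\<close>, and \<open>F(A)\<close> misses the barred copy of \<open>b\<close>. Let \<open>c\<close> be the largest externally active
  element of \<open>Cocirc(B,b)\<close> or, if there is none, the minimum of \<open>Cocirc(B,b)\<close>, and put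
  \<open>C = B - b + c\<close>. This choice makes every element outside \<open>B + c\<close> externally active for \<open>C\<close> iff
  it is so for \<open>B\<close>, hence \<open>F(C)\<close> meets \<open>F(B)\<close> in \<open>F(B)\<close> minus the barred \<open>b\<close>; and \<open>C \<le> B\<close> because
  \<open>c\<close> is either externally active in \<open>B\<close> or internally active in \<open>C\<close>.

  A linear extension exists because \<open>A \<le> B\<close> implies that \<open>A\<close> is lexicographically at most \<open>B\<close>:
  if the least element \<open>e\<close> of the symmetric difference were in \<open>B\<close>, symmetric exchange would give
  \<open>x > e\<close> in \<open>A - B\<close> with \<open>A - x + e\<close> and \<open>B - e + x\<close> bases, so \<open>x\<close> would lie in both \<open>IP(A)\<close>
  and \<open>EP(B)\<close>.\<close>

section \<open>Bases, fundamental circuits and exchange properties\<close>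

context matroid
begin

lemma finite_basis: "B \<in> \<B> \<Longrightarrow> finite B"
  using bases_subset finite_ground finite_subset by blast

text \<open>Each exchange shrinks \<open>A - B\<close> and preserves the size of \<open>A\<close>;
  exchange also excludes a proper inclusion between bases.\<close>

lemma card_bases_eq:
  assumes "A \<in> \<B>" "B \<in> \<B>"
  shows "card A = card B"
  using assms(1)
proof (induction "card (A - B)" arbitrary: A rule: less_induct)
  case less
  show ?case
  proof (cases "A \<subseteq> B")
    case True
    then have "A = B"
      using basis_exchange[OF assms(2) less.prems] by blast
    then show ?thesis by simp
  next
    case False
    then obtain x where x: "x \<in> A - B" by blast
    then obtain y where y: "y \<in> B - A" "insert y (A - {x}) \<in> \<B>"
      using basis_exchange[OF less.prems assms(2)] by blast
    have fin: "finite A" using finite_basis less.prems by blast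
    have "insert y (A - {x}) - B \<subset> A - B" using x y(1) by auto
    then have "card (insert y (A - {x}) - B) < card (A - B)"
      by (simp add: fin psubset_card_mono)
    then have "card (insert y (A - {x})) = card B"
      using less.hyps y(2) by blast
    moreover have "card (insert y (A - {x})) = card A"
      using x y(1) fin card_Suc_Diff1[of A x] by (simp del: card_Diff_insert)
    ultimately show ?thesis by simp
  qed
qed

text \<open>Exchange against \<open>B\<close> removes the elements outside
  \<open>I \<union> B\<close> one at a time and never touches \<open>I\<close>.\<close>

lemma indep_extension:
  assumes "indep \<B> I" "B \<in> \<B>"
  obtains D where "D \<in> \<B>" "I \<subseteq> D" "D \<subseteq> I \<union> B"
proof -
  have "\<exists>D\<in>\<B>. I \<subseteq> D \<and> D \<subseteq> I \<union> B" if "D \<in> \<B>" "I \<subseteq> D" for D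
    using that
  proof (induction "card (D - (I \<union> B))" arbitrary: D rule: less_induct)
    case less
    show ?case
    proof (cases "D \<subseteq> I \<union> B")
      case False
      then obtain x where x: "x \<in> D - (I \<union> B)" by blast
      then obtain y where y: "y \<in> B - D" "insert y (D - {x}) \<in> \<B>"
        using basis_exchange[OF less.prems(1) assms(2)] by blast
      have "insert y (D - {x}) - (I \<union> B) \<subset> D - (I \<union> B)" using x y(1) by auto
      then have "card (insert y (D - {x}) - (I \<union> B)) < card (D - (I \<union> B))"
        by (simp add: finite_basis less.prems psubset_card_mono)
      moreover have "I \<subseteq> insert y (D - {x})" using x less.prems by blast
      ultimately show ?thesis using less.hyps y(2) by blast
    qed (use less.prems in blast)
  qed
  then show thesis using assms(1) that unfolding indep_def by meson
qed

text \<open>A basis inside \<open>insert e B\<close> containing this set would, by cardinality, omit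
  exactly one element \<open>x\<close>; but then \<open>x\<close> belongs to the set.\<close>

lemma fundamental_circuit_dependent:
  assumes "B \<in> \<B>" "e \<in> E - B"
  shows "\<not> indep \<B> {x \<in> insert e B. insert e B - {x} \<in> \<B>}" (is "\<not> indep \<B> ?K")
proof
  assume "indep \<B> ?K"
  then obtain D where D: "D \<in> \<B>" "?K \<subseteq> D" "D \<subseteq> ?K \<union> B"
    using indep_extension assms(1) by blast
  have sub: "D \<subseteq> insert e B" using D(3) by blast
  have fin: "finite (insert e B)" using assms finite_basis by simp
  have "card (insert e B - D) = card (insert e B) - card D"
    using sub fin by (meson card_Diff_subset finite_subset)
  also have "\<dots> = 1"
    using card_bases_eq[OF D(1) assms(1)] assms finite_basis by simp
  finally obtain x where x: "insert e B - D = {x}"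
    by (auto simp: card_1_singleton_iff)
  have "insert e B - {x} = D" using x sub by blast
  then have "insert e B - {x} \<in> \<B>" using D(1) by simp
  moreover have "x \<in> insert e B" "x \<notin> D" using x by blast+
  ultimately show False using D(2) by blast
qed

text \<open>Every dependent subset of \<open>insert e B\<close> contains each element whose removal
  leaves a basis, so the dependent set of all these elements is the only circuit there.\<close>

lemma Circ_eq:
  assumes "B \<in> \<B>" "e \<in> E - B"
  shows "Circ E \<B> B e = {x \<in> insert e B. insert e B - {x} \<in> \<B>}" (is "_ = ?K")
proof -
  have least: "?K \<subseteq> C" if "\<not> indep \<B> C" "C \<subseteq> insert e B" for C
  proof
    fix x assume "x \<in> ?K"
    then have "\<not> C \<subseteq> insert e B - {x}" using that(1) unfolding indep_def by auto
    then show "x \<in> C" using that(2) by auto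
  qed
  have dep: "\<not> indep \<B> ?K" by (rule fundamental_circuit_dependent[OF assms])
  have "circuit E \<B> ?K"
    unfolding circuit_def
  proof (intro conjI allI impI)
    show "?K \<subseteq> E" using bases_subset[OF assms(1)] assms(2) by auto
    show "indep \<B> D" if "D \<subset> ?K" for D
      using least[of D] that by (metis (lifting) mem_Collect_eq psubsetE subsetI subset_trans)
  qed (fact dep)
  moreover have "C = ?K" if "circuit E \<B> C" "C \<subseteq> insert e B" for C
    using that least[of C] dep unfolding circuit_def by (metis (lifting) psubsetI)
  moreover have "?K \<subseteq> insert e B" by blast
  ultimately show ?thesis
    unfolding Circ_def by (intro the_equality conjI) (assumption | elim conjE)+
qed

text \<open>With \<open>K\<close> the fundamental circuit of \<open>e\<close> over \<open>A\<close>,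
  extend \<open>K - {e}\<close> to a basis \<open>D\<close> by elements of \<open>B\<close>. Since
  \<open>e\<close> is not in \<open>D\<close>, exchanging \<open>e\<close> out of \<open>B\<close>
  against \<open>D\<close> brings in some \<open>x\<close> of \<open>K - {e}\<close>, which serves
  both exchanges.\<close>

lemma symmetric_exchange:
  assumes "A \<in> \<B>" "B \<in> \<B>" "e \<in> B - A"
  obtains x where "x \<in> A - B" "insert e (A - {x}) \<in> \<B>" "insert x (B - {e}) \<in> \<B>"
proof -
  define K where "K = {x \<in> insert e A. insert e A - {x} \<in> \<B>}"
  have "e \<in> E - A" using assms bases_subset by blast
  then have dep: "\<not> indep \<B> K"
    unfolding K_def by (rule fundamental_circuit_dependent[OF assms(1)])
  have "indep \<B> (K - {e})"
    unfolding indep_def K_def using assms(1) by (intro bexI[of _ A]) auto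
  then obtain D where D: "D \<in> \<B>" "K - {e} \<subseteq> D" "D \<subseteq> (K - {e}) \<union> B"
    using indep_extension assms(2) by blast
  have "e \<notin> D" using dep D unfolding indep_def by blast
  then obtain x where x: "x \<in> D - B" "insert x (B - {e}) \<in> \<B>"
    using basis_exchange[OF assms(2) D(1)] assms(3) by blast
  then have "x \<in> K" "x \<noteq> e" using D(3) by auto
  then have "x \<in> A - B" "insert e (A - {x}) \<in> \<B>"
    using x unfolding K_def by (auto simp: insert_Diff_if)
  then show thesis using that x by blast
qed

text \<open>When \<open>y\<close> leaves \<open>B\<close>, the second basis can only supply
  \<open>x\<close> or \<open>c\<close>.\<close>

lemma double_exchange_add:
  assumes "B \<in> \<B>" "insert x (insert c (B - {b, y})) \<in> \<B>" "y \<in> B" "x \<notin> B" "c \<notin> B"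
  shows "insert c (B - {y}) \<in> \<B> \<or> insert x (B - {y}) \<in> \<B>"
  using basis_exchange[OF assms(1,2), of y] assms(3-) by auto

text \<open>When \<open>c\<close> leaves the second basis, \<open>B\<close> can only supply
  \<open>b\<close> or \<open>y\<close>.\<close>

lemma double_exchange_remove:
  assumes "B \<in> \<B>" "insert x (insert c (B - {b, y})) \<in> \<B>"
    "b \<in> B" "y \<in> B" "b \<noteq> y" "x \<notin> B" "c \<notin> B" "x \<noteq> c"
  shows "insert x (B - {y}) \<in> \<B> \<or> insert x (B - {b}) \<in> \<B>"
proof -
  obtain z where z: "z \<in> B - insert x (insert c (B - {b, y}))"
      "insert z (insert x (insert c (B - {b, y})) - {c}) \<in> \<B>"
    using basis_exchange[OF assms(2,1), of c] assms by blast
  moreover have "insert b (insert x (insert c (B - {b, y})) - {c}) = insert x (B - {y})"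
    "insert y (insert x (insert c (B - {b, y})) - {c}) = insert x (B - {b})"
    using assms by auto
  moreover have "z = b \<or> z = y" using z(1) by blast
  ultimately show ?thesis by metis
qed

end

section \<open>Minima and activities with respect to a linear order\<close>

locale ordered_matroid = matroid +
  fixes r :: "('a \<times> 'a) set"
  assumes linear: "linear_order_on E r"
begin

lemma order_refl: "x \<in> E \<Longrightarrow> (x, x) \<in> r"
  using linear unfolding linear_order_on_def partial_order_on_def preorder_on_def
  by (blast dest: refl_onD)

lemma order_antisym: "(x, y) \<in> r \<Longrightarrow> (y, x) \<in> r \<Longrightarrow> x = y"
  using linear unfolding linear_order_on_def partial_order_on_def by (blast dest: antisymD)

lemma order_trans: "(x, y) \<in> r \<Longrightarrow> (y, z) \<in> r \<Longrightarrow> (x, z) \<in> r"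
  using linear unfolding linear_order_on_def partial_order_on_def preorder_on_def
  by (blast dest: transD)

lemma order_total: "x \<in> E \<Longrightarrow> y \<in> E \<Longrightarrow> (x, y) \<in> r \<or> (y, x) \<in> r"
  using linear order_refl unfolding linear_order_on_def total_on_def by metis

lemma ex_min:
  assumes "X \<subseteq> E" "X \<noteq> {}"
  obtains m where "m \<in> X" "\<And>x. x \<in> X \<Longrightarrow> (m, x) \<in> r"
proof -
  have "finite X" using assms finite_ground finite_subset by blast
  then have "\<exists>m\<in>X. \<forall>x\<in>X. (m, x) \<in> r"
    using assms(2,1)
  proof (induction rule: finite_ne_induct)
    case (singleton x)
    then show ?case using order_refl by simp
  next
    case (insert x F)
    then obtain m where "m \<in> F" "\<forall>x\<in>F. (m, x) \<in> r" by auto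
    then show ?case
      using insert.prems order_total[of x m] order_refl[of x] order_trans by blast
  qed
  then show thesis using that by blast
qed

lemma ordered_matroid_converse: "ordered_matroid E \<B> (r\<inverse>)"
  using linear by unfold_locales simp

lemma ex_max:
  assumes "X \<subseteq> E" "X \<noteq> {}"
  obtains m where "m \<in> X" "\<And>x. x \<in> X \<Longrightarrow> (x, m) \<in> r"
  using ordered_matroid.ex_min[OF ordered_matroid_converse assms] by auto

lemma eq_min_wrt_iff:
  assumes "X \<subseteq> E" "x \<in> X"
  shows "x = min_wrt r X \<longleftrightarrow> (\<forall>y\<in>X. (x, y) \<in> r)"
proof -
  obtain m where m: "m \<in> X" "\<And>x. x \<in> X \<Longrightarrow> (m, x) \<in> r"
    using ex_min assms by blast
  have "min_wrt r X = m"
    unfolding min_wrt_def using m order_antisym by (intro the_equality) auto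
  then show ?thesis using m assms order_antisym by blast
qed

text \<open>Apart from \<open>e\<close>, the circuit consists of the elements of \<open>B\<close>
  that \<open>e\<close> can replace, so activity becomes a condition on single exchanges.\<close>

lemma EA_iff:
  assumes "B \<in> \<B>"
  shows "e \<in> EA E \<B> r B \<longleftrightarrow>
    e \<in> E - B \<and> (\<forall>y\<in>B. insert e (B - {y}) \<in> \<B> \<longrightarrow> (e, y) \<in> r)"
proof (cases "e \<in> E - B")
  case True
  have "Circ E \<B> B e \<subseteq> E" "e \<in> Circ E \<B> B e"
    unfolding Circ_eq[OF assms True] using assms True bases_subset[OF assms]
    by (auto simp: insert_Diff_if)
  then have "e \<in> EA E \<B> r B \<longleftrightarrow> (\<forall>y\<in>Circ E \<B> B e. (e, y) \<in> r)"
    unfolding EA_def using True eq_min_wrt_iff by simp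
  also have "\<dots> \<longleftrightarrow> (\<forall>y\<in>B. insert e (B - {y}) \<in> \<B> \<longrightarrow> (e, y) \<in> r)"
    unfolding Circ_eq[OF assms True] using True order_refl by (auto simp: insert_Diff_if)
  finally show ?thesis using True by blast
qed (auto simp: EA_def)

lemma IA_iff:
  assumes "B \<in> \<B>"
  shows "i \<in> IA E \<B> r B \<longleftrightarrow>
    i \<in> B \<and> (\<forall>x\<in>E. insert x (B - {i}) \<in> \<B> \<longrightarrow> (i, x) \<in> r)"
proof (cases "i \<in> B")
  case True
  have "Cocirc E \<B> B i \<subseteq> E" "i \<in> Cocirc E \<B> B i"
    unfolding Cocirc_def using assms True bases_subset by (auto simp: insert_absorb)
  then show ?thesis
    unfolding IA_def using True eq_min_wrt_iff by (auto simp: Cocirc_def)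
qed (simp add: IA_def)

section \<open>External activity under a basis exchange\<close>

text \<open>If \<open>x\<close> can replace \<open>y\<close> in the new basis, double exchange lets
  it replace \<open>y\<close> or \<open>b\<close> in \<open>B\<close>; the latter is excluded, so
  activity in \<open>B\<close> gives \<open>x \<le> y\<close>.\<close>

lemma EA_exchange_outside_cocircuit:
  assumes "B \<in> \<B>" "b \<in> B" "c \<notin> B" "insert c (B - {b}) \<in> \<B>"
    and "insert x (B - {b}) \<notin> \<B>" "x \<noteq> c" "x \<in> EA E \<B> r B"
  shows "x \<in> EA E \<B> r (insert c (B - {b}))"
proof -
  have x: "x \<in> E - B" "\<And>y. y \<in> B \<Longrightarrow> insert x (B - {y}) \<in> \<B> \<Longrightarrow> (x, y) \<in> r"
    using assms EA_iff by auto
  have "x \<noteq> b" using x assms by blast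
  have "(x, y) \<in> r"
    if y: "y \<in> insert c (B - {b})" "insert x (insert c (B - {b}) - {y}) \<in> \<B>" for y
  proof -
    have "y \<noteq> c" using y(2) assms by (auto simp: insert_Diff_if)
    moreover from this have "insert c (B - {b}) - {y} = insert c (B - {b, y})" by auto
    ultimately show ?thesis
      using double_exchange_remove[of B x c b y] y x assms by auto
  qed
  then show ?thesis
    unfolding EA_iff[OF assms(4)] using x assms \<open>x \<noteq> b\<close> by blast
qed

text \<open>If \<open>x\<close> can replace some \<open>y\<close> other than \<open>c\<close> in the
  new basis, then \<open>c\<close> or \<open>x\<close> can replace \<open>y\<close> in
  \<open>B\<close>; either way \<open>x \<le> y\<close>.\<close>

lemma EA_exchange_below:
  assumes "B \<in> \<B>" "b \<in> B" "c \<in> E - B" "insert c (B - {b}) \<in> \<B>"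
    and "\<And>y. y \<in> B - {b} \<Longrightarrow> insert c (B - {y}) \<in> \<B> \<Longrightarrow> (x, y) \<in> r"
    and "(x, c) \<in> r" "x \<noteq> c" "x \<in> EA E \<B> r B"
  shows "x \<in> EA E \<B> r (insert c (B - {b}))"
proof -
  have x: "x \<in> E - B" "\<And>y. y \<in> B \<Longrightarrow> insert x (B - {y}) \<in> \<B> \<Longrightarrow> (x, y) \<in> r"
    using assms EA_iff by auto
  have "x \<noteq> b" using x assms by blast
  have "(x, y) \<in> r"
    if y: "y \<in> insert c (B - {b})" "insert x (insert c (B - {b}) - {y}) \<in> \<B>" for y
  proof (cases "y = c")
    case False
    then have "insert c (B - {b}) - {y} = insert c (B - {b, y})" by auto
    then have "insert c (B - {y}) \<in> \<B> \<or> insert x (B - {y}) \<in> \<B>"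
      using double_exchange_add[of B x c b y] y x assms False by auto
    then show ?thesis
      using y False x assms(5)[of y] by blast
  qed (use assms in simp)
  then show ?thesis
    unfolding EA_iff[OF assms(4)] using x assms \<open>x \<noteq> b\<close> by blast
qed

text \<open>The exchange is reversible, so the two preceding lemmas apply in both directions. If
  \<open>x\<close> lies in the cocircuit and above \<open>c\<close>, it can replace \<open>c\<close>
  in the new basis and is inactive there; if below, \<open>x \<le> c\<close> and the activity of
  \<open>c\<close> bound \<open>x\<close> by everything that \<open>c\<close> can replace.\<close>

lemma EA_exchange_iff:
  assumes "B \<in> \<B>" "b \<in> B" "c \<in> E - B" "insert c (B - {b}) \<in> \<B>" "(c, b) \<in> r"
    and x: "x \<noteq> c" "x \<notin> B"
    and sep: "x \<in> E \<Longrightarrow> insert x (B - {b}) \<in> \<B> \<Longrightarrow>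
      (c, x) \<in> r \<and> x \<notin> EA E \<B> r B \<or> (x, c) \<in> r \<and> c \<in> EA E \<B> r B"
  shows "x \<in> EA E \<B> r (insert c (B - {b})) \<longleftrightarrow> x \<in> EA E \<B> r B"
proof -
  let ?C = "insert c (B - {b})"
  have cancel: "insert b (B - {b}) = B" using assms(2) by auto
  have del: "?C - {c} = B - {b}" using assms(3) by auto
  have bE: "b \<in> E - ?C" using assms(2,3) bases_subset[OF assms(1)] by blast
  have "b \<noteq> x" using assms(2) x by blast
  show ?thesis
  proof (cases "x \<in> E")
    case xE: True
    show ?thesis
    proof (cases "insert x (B - {b}) \<in> \<B>")
      case False
      have "x \<in> EA E \<B> r B" if "x \<in> EA E \<B> r ?C"
        using EA_exchange_outside_cocircuit[of ?C c b x] that False assms(1-4) \<open>b \<noteq> x\<close> bE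
        unfolding del cancel by blast
      moreover have "x \<in> EA E \<B> r ?C" if "x \<in> EA E \<B> r B"
        using EA_exchange_outside_cocircuit[of B b c x] that False assms by blast
      ultimately show ?thesis by blast
    next
      case True
      then consider (above) "(c, x) \<in> r" "x \<notin> EA E \<B> r B"
        | (below) "(x, c) \<in> r" "c \<in> EA E \<B> r B"
        using sep xE by blast
      then show ?thesis
      proof cases
        case above
        have "(x, c) \<notin> r" using above x order_antisym by blast
        moreover have "insert x (?C - {c}) \<in> \<B>" using True unfolding del .
        ultimately have "x \<notin> EA E \<B> r ?C"
          using EA_iff[OF assms(4), of x] by blast
        then show ?thesis using above by blast
      next
        case below
        have c: "\<And>y. y \<in> B \<Longrightarrow> insert c (B - {y}) \<in> \<B> \<Longrightarrow> (c, y) \<in> r"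
          using EA_iff[OF assms(1)] below by blast
        have up: "(x, y) \<in> r" if "y \<in> B" "insert c (B - {y}) \<in> \<B>" for y
          using c[OF that] order_trans[OF below(1)] by blast
        have xb: "(x, b) \<in> r" using up assms(2,4) by blast
        \<comment> \<open>For undoing the exchange: an element of \<open>B - {b}\<close> replaceable
          by \<open>b\<close> in \<open>?C\<close> is replaceable by \<open>c\<close> in
          \<open>B\<close>.\<close>
        have up': "(x, y) \<in> r" if y: "y \<in> ?C - {c}" "insert b (?C - {y}) \<in> \<B>" for y
        proof -
          have "y \<in> B" using y(1) by blast
          moreover have "insert b (?C - {y}) = insert c (B - {y})" using y(1) assms(2,3) by auto
          ultimately show ?thesis using up y(2) by simp
        qed
        have "x \<in> EA E \<B> r B" if "x \<in> EA E \<B> r ?C"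
          using EA_exchange_below[of ?C c b x] assms(1,4) bE up' xb \<open>b \<noteq> x\<close> that
          unfolding del cancel by blast
        moreover have "x \<in> EA E \<B> r ?C" if "x \<in> EA E \<B> r B"
          using EA_exchange_below[OF assms(1-4) _ below(1) x(1) that] up by simp
        ultimately show ?thesis by blast
      qed
    qed
  qed (auto simp: EA_def)
qed

section \<open>Facets and purity of the complex\<close>

text \<open>\<open>B\<close>, \<open>EP\<close> and \<open>EA\<close> partition \<open>E\<close>,
  and only elements of \<open>B\<close> contribute both copies.\<close>

lemma card_act_facet:
  assumes "B \<in> \<B>"
  shows "card (act_facet E \<B> r B) = card E + card B"
proof -
  have fin: "finite B" "finite (EP E \<B> r B)" "finite (EA E \<B> r B)"
    using finite_basis[OF assms] finite_ground by (auto simp: EP_def EA_def)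
  have un: "B \<union> EP E \<B> r B \<union> EA E \<B> r B = E"
    using bases_subset[OF assms] by (auto simp: EP_def EA_def)
  have disj: "B \<inter> EP E \<B> r B = {}" "B \<inter> EA E \<B> r B = {}"
    "(B \<union> EP E \<B> r B) \<inter> EA E \<B> r B = {}"
    by (auto simp: EP_def EA_def)
  have "card E = card B + card (EP E \<B> r B) + card (EA E \<B> r B)"
    using fin disj by (subst un[symmetric]) (simp add: card_Un_disjoint)
  then show ?thesis
    unfolding act_facet_def using fin disj by (simp add: card_Plus card_Un_disjoint)
qed

lemma inj_on_act_facet: "inj_on (act_facet E \<B> r) \<B>"
proof (rule inj_onI)
  fix A B assume eq: "act_facet E \<B> r A = act_facet E \<B> r B"
  have "C = {x. Inl x \<in> act_facet E \<B> r C \<and> Inr x \<in> act_facet E \<B> r C}" for C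
    by (auto simp: act_facet_def EP_def)
  from this[of A] this[of B] show "A = B" unfolding eq by simp
qed

lemma finite_act_facet: "B \<in> \<B> \<Longrightarrow> finite (act_facet E \<B> r B)"
  unfolding act_facet_def using finite_basis finite_ground by (auto simp: EP_def EA_def)

text \<open>The generators have equal size, so none properly contains another.\<close>

lemma facets_Act: "facets (Act E \<B> r) = act_facet E \<B> r ` \<B>"
proof -
  have "act_facet E \<B> r A = act_facet E \<B> r B"
    if "A \<in> \<B>" "B \<in> \<B>" "act_facet E \<B> r A \<subseteq> act_facet E \<B> r B" for A B
    using that card_act_facet card_bases_eq[of A B] finite_act_facet
    by (intro card_subset_eq) auto
  then show ?thesis
    unfolding facets_def Act_def by blast
qed

lemma pure_Act: "pure_complex (E <+> E) (Act E \<B> r)"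
proof -
  have "act_facet E \<B> r B \<subseteq> E <+> E" if "B \<in> \<B>" for B
    unfolding act_facet_def using bases_subset[OF that] by (auto simp: EP_def EA_def)
  then have "simplicial_complex (E <+> E) (Act E \<B> r)"
    unfolding simplicial_complex_def Act_def using finite_ground bases_nonempty
    by (fastforce simp: finite_Plus)
  moreover have "card \<sigma> = card \<tau>"
    if "\<sigma> \<in> facets (Act E \<B> r)" "\<tau> \<in> facets (Act E \<B> r)" for \<sigma> \<tau>
    using that card_act_facet card_bases_eq unfolding facets_Act by (metis imageE)
  ultimately show ?thesis unfolding pure_complex_def by blast
qed

section \<open>The shelling condition\<close>

text \<open>\<open>C\<close> provides the earlier facet: \<open>F(A)\<close> misses the barred
  \<open>b\<close>, so its intersection with \<open>F(B)\<close> lies in that of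
  \<open>F(C)\<close>, while \<open>C \<le> B\<close> and \<open>C \<noteq> B\<close> place
  \<open>C\<close> strictly before \<open>B\<close> in every linear extension.\<close>

lemma act_facet_step:
  assumes A: "A \<in> \<B>" and B: "B \<in> \<B>" and "(B, A) \<notin> ext_int_order E \<B> r"
  obtains C b where "C \<in> \<B>" "C \<noteq> B" "(C, B) \<in> ext_int_order E \<B> r"
    "Inr b \<in> act_facet E \<B> r B" "Inr b \<notin> act_facet E \<B> r A"
    "act_facet E \<B> r C \<inter> act_facet E \<B> r B = act_facet E \<B> r B - {Inr b}"
proof -
  obtain b where bIP: "b \<in> IP E \<B> r B" and bEP: "b \<in> EP E \<B> r A"
    using assms unfolding ext_int_order_def by blast
  have b: "b \<in> B" "b \<in> E" "b \<notin> IA E \<B> r B"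
    using bIP bases_subset[OF B] by (auto simp: IP_def)
  let ?X = "{x \<in> E. insert x (B - {b}) \<in> \<B>}"
  \<comment> \<open>\<open>?X\<close> is the cocircuit of \<open>b\<close> in \<open>B\<close>. The
    activity alternative yields \<open>C \<le> B\<close>; the last conjunct is the separation
    hypothesis of \<open>EA_exchange_iff\<close>.\<close>
  have "\<exists>c\<in>?X. c \<noteq> b \<and> (c, b) \<in> r \<and>
      (c \<in> EA E \<B> r B \<or> (\<forall>x\<in>?X. (c, x) \<in> r)) \<and>
      (\<forall>x\<in>?X - B. (c, x) \<in> r \<and> (x \<noteq> c \<longrightarrow> x \<notin> EA E \<B> r B)
                   \<or> (x, c) \<in> r \<and> c \<in> EA E \<B> r B)"
  proof (cases "?X \<inter> EA E \<B> r B = {}")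
    case True
    have "b \<in> ?X" using b B by (simp add: insert_absorb)
    then obtain c where c: "c \<in> ?X" "\<And>x. x \<in> ?X \<Longrightarrow> (c, x) \<in> r"
      using ex_min[of ?X] by blast
    \<comment> \<open>\<open>b\<close> is not internally active in \<open>B\<close>, so it is not
      the minimum of its cocircuit.\<close>
    have "c \<noteq> b" using c b IA_iff[OF B] by auto
    then show ?thesis using c True \<open>b \<in> ?X\<close> by blast
  next
    case False
    then obtain c where c: "c \<in> ?X \<inter> EA E \<B> r B"
        "\<And>x. x \<in> ?X \<inter> EA E \<B> r B \<Longrightarrow> (x, c) \<in> r"
      using ex_max[of "?X \<inter> EA E \<B> r B"] by blast
    have "c \<noteq> b" "(c, b) \<in> r" using c b EA_iff[OF B] by auto
    moreover have "(c, x) \<in> r \<and> (x \<noteq> c \<longrightarrow> x \<notin> EA E \<B> r B) \<or> (x, c) \<in> r" if "x \<in> ?X" for x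
      using c that order_total[of x c] by blast
    ultimately show ?thesis using c by blast
  qed
  then obtain c where c: "c \<in> E" "insert c (B - {b}) \<in> \<B>" "c \<noteq> b" "(c, b) \<in> r"
    and c_act: "c \<in> EA E \<B> r B \<or> (\<forall>x\<in>?X. (c, x) \<in> r)"
    and sep: "\<And>x. x \<in> ?X - B \<Longrightarrow> (c, x) \<in> r \<and> (x \<noteq> c \<longrightarrow> x \<notin> EA E \<B> r B)
                   \<or> (x, c) \<in> r \<and> c \<in> EA E \<B> r B"
    by blast
  let ?C = "insert c (B - {b})"
  have cB: "c \<notin> B"
  proof
    assume "c \<in> B"
    then have "?C \<subset> B" using b c by auto
    then have "card ?C < card B" using finite_basis[OF B] psubset_card_mono by blast
    then show False using card_bases_eq[OF B c(2)] by simp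
  qed
  have del: "?C - {c} = B - {b}" using cB by auto
  have EA_C: "x \<in> EA E \<B> r ?C \<longleftrightarrow> x \<in> EA E \<B> r B" if "x \<noteq> c" "x \<notin> B" for x
    using EA_exchange_iff[OF B b(1) _ c(2,4), of x] c(1) cB that sep[of x] by blast
  have bC: "b \<in> EP E \<B> r ?C"
  proof -
    have "(b, c) \<notin> r" using c order_antisym by blast
    moreover have "insert b (?C - {c}) \<in> \<B>" using B b(1) cB by (simp add: insert_absorb)
    ultimately show ?thesis
      unfolding EP_def using b(2) c(3) EA_iff[OF c(2), of b] by blast
  qed
  \<comment> \<open>Elements of \<open>B\<close> never lie in \<open>EP E \<B> r B\<close>, so only
    \<open>c\<close> has to be excluded.\<close>
  have "IP E \<B> r ?C \<inter> EP E \<B> r B = {}"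
  proof -
    have "c \<in> IA E \<B> r ?C" if "\<forall>x\<in>?X. (c, x) \<in> r"
      using that IA_iff[OF c(2), of c] unfolding del by blast
    then show ?thesis using c_act unfolding IP_def EP_def by blast
  qed
  then have "(?C, B) \<in> ext_int_order E \<B> r"
    unfolding ext_int_order_def using B c(2) by blast
  moreover have "Inr b \<in> act_facet E \<B> r B" "Inr b \<notin> act_facet E \<B> r A"
    using b bEP unfolding act_facet_def EP_def by auto
  moreover have "act_facet E \<B> r ?C \<inter> act_facet E \<B> r B = act_facet E \<B> r B - {Inr b}"
  proof -
    \<comment> \<open>Nothing is lost on the unbarred side, because \<open>b\<close> becomes
      externally passive in \<open>?C\<close>; on the barred side exactly \<open>b\<close> is
      lost.\<close>
    have "B \<union> EP E \<B> r B \<subseteq> ?C \<union> EP E \<B> r ?C"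
      using bC EA_C unfolding EP_def by auto
    moreover have "(B - {b}) \<union> EA E \<B> r B \<subseteq> ?C \<union> EA E \<B> r ?C"
      using EA_C by (auto simp: EA_def[of E \<B> r B])
    moreover have "b \<notin> ?C \<union> EA E \<B> r ?C" "b \<notin> EA E \<B> r B"
      using bC b unfolding EP_def EA_def by auto
    ultimately show ?thesis unfolding act_facet_def by (intro equalityI) (auto simp: subset_iff)
  qed
  moreover have "?C \<noteq> B" using cB by auto
  ultimately show thesis using that c(2) by blast
qed

lemma linear_extension_shelling:
  assumes "linear_extension \<B> (ext_int_order E \<B> r) Bs"
  shows "shelling_order (E <+> E) (Act E \<B> r) (map (act_facet E \<B> r) Bs)"
proof -
  let ?F = "act_facet E \<B> r"
  have Bs: "distinct Bs" "set Bs = \<B>"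
    and ext: "\<And>i j. i < length Bs \<Longrightarrow> j < length Bs \<Longrightarrow>
      (Bs ! i, Bs ! j) \<in> ext_int_order E \<B> r \<Longrightarrow> i \<le> j"
    using assms unfolding linear_extension_def by auto
  let ?Fs = "map ?F Bs"
  have step: "\<exists>l<j. \<exists>f\<in>?Fs ! j. ?Fs ! i \<inter> ?Fs ! j \<subseteq> ?Fs ! l \<inter> ?Fs ! j \<and>
      ?Fs ! l \<inter> ?Fs ! j = ?Fs ! j - {f}"
    if "j < length Bs" "i < j" for i j
  proof -
    have "Bs ! i \<in> \<B>" "Bs ! j \<in> \<B>" "(Bs ! j, Bs ! i) \<notin> ext_int_order E \<B> r"
      using that Bs ext[of j i] nth_mem[of i Bs] nth_mem[of j Bs] by auto
    then obtain C b where C: "C \<in> \<B>" "C \<noteq> Bs ! j" "(C, Bs ! j) \<in> ext_int_order E \<B> r"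
      and b: "Inr b \<in> ?F (Bs ! j)" "Inr b \<notin> ?F (Bs ! i)"
        "?F C \<inter> ?F (Bs ! j) = ?F (Bs ! j) - {Inr b}"
      by (rule act_facet_step)
    obtain l where l: "l < length Bs" "Bs ! l = C"
      using C Bs by (metis in_set_conv_nth)
    then have "l < j" using ext[of l j] C that by (cases "l = j") auto
    moreover have "?Fs ! j = ?F (Bs ! j)" "?Fs ! i = ?F (Bs ! i)" "?Fs ! l = ?F C"
      using that l by simp_all
    ultimately show ?thesis using b by (intro exI[of _ l] conjI bexI[of _ "Inr b"]) auto
  qed
  have "distinct ?Fs" "set ?Fs = facets (Act E \<B> r)"
    using Bs inj_on_act_facet by (simp_all add: distinct_map facets_Act)
  then show ?thesis
    unfolding shelling_order_def length_map using pure_Act step by blast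
qed

section \<open>Existence of a linear extension\<close>

text \<open>Comparing the values of \<open>lex_weight\<close> amounts to comparing sets lexicographically, smaller
  elements of \<open>E\<close> being more significant.\<close>

definition num_above :: "'a \<Rightarrow> nat" where
  "num_above e = card {x \<in> E. (e, x) \<in> r \<and> x \<noteq> e}"

definition lex_weight :: "'a set \<Rightarrow> nat" where
  "lex_weight A = (\<Sum>e\<in>A. 2 ^ num_above e)"

lemma num_above_less:
  assumes "x \<in> E" "(e, x) \<in> r" "x \<noteq> e"
  shows "num_above x < num_above e"
  unfolding num_above_def
proof (rule psubset_card_mono)
  show "{y \<in> E. (x, y) \<in> r \<and> y \<noteq> x} \<subset> {y \<in> E. (e, y) \<in> r \<and> y \<noteq> e}"
    using assms order_trans order_antisym by blast
qed (use finite_ground in simp)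

lemma inj_on_num_above: "inj_on num_above E"
  using num_above_less order_total by (intro inj_onI) (metis less_irrefl)

text \<open>The common part cancels. The elements of \<open>A - B\<close> have distinct binary
  positions below that of \<open>e\<close>, so together they weigh less than \<open>e\<close>
  alone.\<close>

lemma lex_weight_less:
  assumes "A \<subseteq> E" "B \<subseteq> E" "e \<in> B - A" "\<And>x. x \<in> A - B \<Longrightarrow> (e, x) \<in> r"
  shows "lex_weight A < lex_weight B"
proof -
  have fin: "finite A" "finite B" using assms finite_ground finite_subset by blast+
  have "lex_weight (A - B) = (\<Sum>i\<in>num_above ` (A - B). 2 ^ i)"
    unfolding lex_weight_def
    using inj_on_num_above assms(1)
    by (subst sum.reindex) (auto intro: inj_on_subset)
  also have "\<dots> \<le> (\<Sum>i<num_above e. 2 ^ i)"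
  proof (rule sum_mono2)
    show "num_above ` (A - B) \<subseteq> {..<num_above e}"
      using num_above_less assms by fastforce
  qed auto
  also have "\<dots> < 2 ^ num_above e" by (simp add: lessThan_atLeast0 sum_power2)
  also have "\<dots> \<le> lex_weight (B - A)"
    unfolding lex_weight_def using assms fin by (intro member_le_sum) auto
  finally have "lex_weight (A - B) < lex_weight (B - A)" .
  moreover have "lex_weight A = lex_weight (A \<inter> B) + lex_weight (A - B)"
    "lex_weight B = lex_weight (A \<inter> B) + lex_weight (B - A)"
    unfolding lex_weight_def using fin sum.Int_Diff[of A _ B] sum.Int_Diff[of B _ A]
    by (auto simp: Int_commute)
  ultimately show ?thesis by simp
qed

text \<open>The lexicographically smaller basis contains the least element of the symmetric
  difference and is therefore the heavier one.\<close>

lemma lex_weight_ext_int_order: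
  assumes "(A, B) \<in> ext_int_order E \<B> r" "A \<noteq> B"
  shows "lex_weight B < lex_weight A"
proof -
  have A: "A \<in> \<B>" and B: "B \<in> \<B>" and disj: "IP E \<B> r A \<inter> EP E \<B> r B = {}"
    using assms unfolding ext_int_order_def by auto
  have sub: "A \<subseteq> E" "B \<subseteq> E" using A B bases_subset by auto
  obtain e where e: "e \<in> (A - B) \<union> (B - A)" "\<And>x. x \<in> (A - B) \<union> (B - A) \<Longrightarrow> (e, x) \<in> r"
    using ex_min[of "(A - B) \<union> (B - A)"] sub assms(2) by blast
  have "e \<notin> B - A"
  proof
    assume eB: "e \<in> B - A"
    then obtain x where x: "x \<in> A - B" "insert e (A - {x}) \<in> \<B>" "insert x (B - {e}) \<in> \<B>"
      using symmetric_exchange A B by blast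
    then have "(x, e) \<notin> r" using e eB order_antisym by blast
    then have "x \<in> IP E \<B> r A" "x \<in> EP E \<B> r B"
      unfolding IP_def EP_def using x eB sub IA_iff[OF A, of x] EA_iff[OF B, of x] by blast+
    then show False using disj by blast
  qed
  then show ?thesis using lex_weight_less[of B A e] sub e by blast
qed

lemma ex_linear_extension: "\<exists>Bs. linear_extension \<B> (ext_int_order E \<B> r) Bs"
proof -
  have "finite \<B>"
    using bases_subset finite_ground by (meson Pow_iff finite_Pow_iff finite_subset subsetI)
  then obtain xs where xs: "set xs = \<B>" "distinct xs"
    using finite_distinct_list by blast
  \<comment> \<open>Reversed because the weight strictly decreases along the order; bases of equal
    weight may come in any order, being equal or incomparable.\<close>
  define Bs where "Bs = rev (sort_key lex_weight xs)"
  have Bs: "set Bs = \<B>" "distinct Bs" "sorted (rev (map lex_weight Bs))"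
    unfolding Bs_def using xs by (auto simp: rev_map)
  have "i \<le> j" if "i < length Bs" "j < length Bs" "(Bs ! i, Bs ! j) \<in> ext_int_order E \<B> r" for i j
  proof (rule ccontr)
    assume "\<not> i \<le> j"
    then have "lex_weight (Bs ! i) \<le> lex_weight (Bs ! j)"
      using sorted_rev_nth_mono[OF Bs(3), of j i] that by simp
    moreover have "Bs ! i \<noteq> Bs ! j"
      using Bs(2) that \<open>\<not> i \<le> j\<close> nth_eq_iff_index_eq by fastforce
    ultimately show False using lex_weight_ext_int_order that by fastforce
  qed
  then show ?thesis unfolding linear_extension_def using Bs by blast
qed

end

theorem theorem1p1:
  fixes E :: "'a set" and \<B> :: "'a set set" and r :: "('a \<times> 'a) set"
  assumes "matroid E \<B>"
    and "linear_order_on E r"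
  shows "(\<forall>Bs. linear_extension \<B> (ext_int_order E \<B> r) Bs \<longrightarrow>
              shelling_order (E <+> E) (Act E \<B> r) (map (act_facet E \<B> r) Bs)) \<and>
         shellable (E <+> E) (Act E \<B> r)"
proof -
  interpret ordered_matroid E \<B> r
    using assms by (simp add: ordered_matroid_def ordered_matroid_axioms_def)
  show ?thesis
    using linear_extension_shelling ex_linear_extension unfolding shellable_def by blast
qed

end
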